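(* Let $i\in\{1,2\}$, $\varepsilon=(-1)^i$, and let $\mathcal{S}_i$ be the timelike general rotational surface of first type ($i=1$) or second type ($i=2$) determined by $f,g,\alpha,\beta$. Let $\lambda,\mu\in\mathbb{R}$ be not both zero and equip $\mathbb{E}_1^4$ with the density $e^{\lambda(x^2+y^2)+\mu(z^2-t^2)}$. Then $\mathcal{S}_i$ is weighted minimal if and only if $$\begin{aligned}&\left(\left(-2\varepsilon\mu\alpha^2f^2+\beta^2\right)f'g+\alpha^2fg'-2\beta^2\mu g^3f'\right)\left(f'^2-\varepsilon g'^2\right)\\&\quad+\left((\alpha f)^2+\varepsilon(\beta g)^2\right)\left(\left(-2\lambda f\left(-\varepsilon f'^2+g'^2\right)-f''\right)g'+f'g''\right)=0\end{aligned}$$ holds (for all $u\in J$).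
   Context: $\mathbb{E}_1^4$ is $\mathbb{R}^4$ with coordinates $(x,y,z,t)$ and the metric $\langle\,,\rangle=dx^2+dy^2+dz^2-dt^2$. Let $\alpha,\beta>0$ be constants, $J\subset\mathbb{R}$ an open interval, $f,g:J\to\mathbb{R}$ smooth functions of $u$ (primes denote $d/du$), and $v\in[0,2\pi)$. First type: $\mathcal{S}_1: X_1(u,v)=(f\cos(\alpha v),f\sin(\alpha v),g\cosh(\beta v),g\sinh(\beta v))$ with $\alpha^2f^2-\beta^2g^2<0$ and $f'^2+g'^2>0$ on $J$. Second type: $\mathcal{S}_2: X_2(u,v)=(f\cos(\alpha v),f\sin(\alpha v),g\sinh(\beta v),g\cosh(\beta v))$ with $f'^2-g'^2<0$ and $\alpha^2f^2+\beta^2g^2>0$ on $J$. Both surfaces are timelike. Normal frame of $\mathcal{S}_1$: $n_1^{\mathcal{S}_1}=\frac{1}{\sqrt{f'^2+g'^2}}(g'\cos(\alpha v),g'\sin(\alpha v),-f'\cosh(\beta v),-f'\sinh(\beta v))$, $n_2^{\mathcal{S}_1}=\frac{1}{\sqrt{(\beta g)^2-(\alpha f)^2}}(-\beta g\sin(\alpha v),\beta g\cos(\alpha v),\alpha f\sinh(\beta v),\alpha f\cosh(\beta v))$. Normal frame of $\mathcal{S}_2$: $n_1^{\mathcal{S}_2}=\frac{1}{\sqrt{(\alpha f)^2+(\beta g)^2}}(\beta g\sin(\alpha v),-\beta g\cos(\alpha v),\alpha f\cosh(\beta v),\alpha f\sinh(\beta v))$, $n_2^{\mathcal{S}_2}=\frac{1}{\sqrt{g'^2-f'^2}}(g'\cos(\alpha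 v),g'\sin(\alpha v),f'\sinh(\beta v),f'\cosh(\beta v))$. With $\varepsilon=(-1)^i$, the $j$-th mean curvatures of $\mathcal{S}_i$ ($j\in\{1,2\}$) are the functions $H_j^{\mathcal{S}_i}=0$ if $j\neq i$, and $$H_i^{\mathcal{S}_i}=\frac{(f'g''-f''g')\left((\alpha f)^2+\varepsilon(\beta g)^2\right)-\varepsilon(\alpha^2fg'+\beta^2gf')(-\varepsilon f'^2+g'^2)}{2(-\varepsilon f'^2+g'^2)^{3/2}\left((\alpha f)^2+\varepsilon(\beta g)^2\right)}.$$ For a density $e^\phi$, the $j$-th weighted mean curvature function is $(H_j^{\mathcal{S}_i})_\phi=H_j^{\mathcal{S}_i}-\frac12\frac{d\phi}{dn_j^{\mathcal{S}_i}}$, where $\frac{d\phi}{dn}=d\phi(n)$ is the directional derivative of $\phi$ along $n$ at the point of the surface. The weighted mean curvature vector field is $\overrightarrow{H_\phi^{\mathcal{S}_i}}=(H_1^{\mathcal{S}_i})_\phi n_1^{\mathcal{S}_i}+(H_2^{\mathcal{S}_i})_\phi n_2^{\mathcal{S}_i}$ and the weighted mean curvature is $H_\phi^{\mathcal{S}_i}=\|\overrightarrow{H_\phi^{\mathcal{S}_i}}\|$, with $\|V\|=\sqrt{|\langle V,V\rangle|}$. The surface is weighted minimal if $H_\phi^{\mathcal{S}_i}$ vanishes identically. *)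

theory Defs
  imports "HOL-Analysis.Analysis"
begin

text \<open>
  Points and vectors of Minkowski 4-space are elements of \<^typ>\<open>real ^ 4\<close> with coordinates
  \<open>(x, y, z, t)\<close>. The derivative, topology and vector space structure are the usual ones of
  \<^typ>\<open>real ^ 4\<close>; its Euclidean inner product and norm are not used.
\<close>

lemma vector_4 [simp]:
  "(vector [a, b, c, d] :: ('a::zero) ^ 4) $ 1 = a"
  "(vector [a, b, c, d] :: ('a::zero) ^ 4) $ 2 = b"
  "(vector [a, b, c, d] :: ('a::zero) ^ 4) $ 3 = c"
  "(vector [a, b, c, d] :: ('a::zero) ^ 4) $ 4 = d"
  unfolding vector_def by simp_all

definition lorentz_inner :: "real ^ 4 \<Rightarrow> real ^ 4 \<Rightarrow> real" where
  "lorentz_inner V W = V $ 1 * W $ 1 + V $ 2 * W $ 2 + V $ 3 * W $ 3 - V $ 4 * W $ 4"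

definition lorentz_norm :: "real ^ 4 \<Rightarrow> real" where
  "lorentz_norm V = sqrt \<bar>lorentz_inner V V\<bar>"

text \<open>Meant for open \<open>J\<close>, where iterating the total operator \<^const>\<open>deriv\<close> gives the genuine
  higher derivatives on \<open>J\<close>, independently of the values of \<open>f\<close> outside \<open>J\<close>.\<close>

definition smooth_on_open :: "real set \<Rightarrow> (real \<Rightarrow> real) \<Rightarrow> bool" where
  "smooth_on_open J f \<longleftrightarrow> (\<forall>n. \<forall>u\<in>J. (deriv ^^ n) f field_differentiable (at u))"

text \<open>The index \<open>i\<close> is the type of the surface, \<open>1\<close> or \<open>2\<close>; the \<open>else\<close> branches below
  describe the second type.\<close>

definition rotational_surface ::
  "nat \<Rightarrow> (real \<Rightarrow> real) \<Rightarrow> (real \<Rightarrow> real) \<Rightarrow> real \<Rightarrow> real \<Rightarrow> real \<Rightarrow> real \<Rightarrow> real ^ 4" where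
  "rotational_surface i f g \<alpha> \<beta> u v =
    (if i = 1
     then vector [f u * cos (\<alpha> * v), f u * sin (\<alpha> * v), g u * cosh (\<beta> * v), g u * sinh (\<beta> * v)]
     else vector [f u * cos (\<alpha> * v), f u * sin (\<alpha> * v), g u * sinh (\<beta> * v), g u * cosh (\<beta> * v)])"

definition timelike_rotational_surface ::
  "nat \<Rightarrow> real set \<Rightarrow> (real \<Rightarrow> real) \<Rightarrow> (real \<Rightarrow> real) \<Rightarrow> real \<Rightarrow> real \<Rightarrow> bool" where
  "timelike_rotational_surface i J f g \<alpha> \<beta> \<longleftrightarrow>
    \<alpha> > 0 \<and> \<beta> > 0 \<and>
    open J \<and> is_interval J \<and> J \<noteq> {} \<and> smooth_on_open J f \<and> smooth_on_open J g \<and>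
    (if i = 1
     then \<forall>u\<in>J. \<alpha>\<^sup>2 * (f u)\<^sup>2 - \<beta>\<^sup>2 * (g u)\<^sup>2 < 0 \<and> (deriv f u)\<^sup>2 + (deriv g u)\<^sup>2 > 0
     else \<forall>u\<in>J. (deriv f u)\<^sup>2 - (deriv g u)\<^sup>2 < 0 \<and> \<alpha>\<^sup>2 * (f u)\<^sup>2 + \<beta>\<^sup>2 * (g u)\<^sup>2 > 0)"

text \<open>The \<open>j\<close>-th vector, \<open>j = 1\<close> or \<open>j = 2\<close>, of the normal frame of the surface of type \<open>i\<close>.\<close>

definition normal_frame ::
  "nat \<Rightarrow> nat \<Rightarrow> (real \<Rightarrow> real) \<Rightarrow> (real \<Rightarrow> real) \<Rightarrow> real \<Rightarrow> real \<Rightarrow> real \<Rightarrow> real \<Rightarrow> real ^ 4" where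
  "normal_frame i j f g \<alpha> \<beta> u v =
    (if i = 1 then
       if j = 1
       then (1 / sqrt ((deriv f u)\<^sup>2 + (deriv g u)\<^sup>2)) *\<^sub>R
         vector [deriv g u * cos (\<alpha> * v), deriv g u * sin (\<alpha> * v),
                 - deriv f u * cosh (\<beta> * v), - deriv f u * sinh (\<beta> * v)]
       else (1 / sqrt ((\<beta> * g u)\<^sup>2 - (\<alpha> * f u)\<^sup>2)) *\<^sub>R
         vector [- \<beta> * g u * sin (\<alpha> * v), \<beta> * g u * cos (\<alpha> * v),
                 \<alpha> * f u * sinh (\<beta> * v), \<alpha> * f u * cosh (\<beta> * v)]
     else
       if j = 1
       then (1 / sqrt ((\<alpha> * f u)\<^sup>2 + (\<beta> * g u)\<^sup>2)) *\<^sub>R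
         vector [\<beta> * g u * sin (\<alpha> * v), - \<beta> * g u * cos (\<alpha> * v),
                 \<alpha> * f u * cosh (\<beta> * v), \<alpha> * f u * sinh (\<beta> * v)]
       else (1 / sqrt ((deriv g u)\<^sup>2 - (deriv f u)\<^sup>2)) *\<^sub>R
         vector [deriv g u * cos (\<alpha> * v), deriv g u * sin (\<alpha> * v),
                 deriv f u * sinh (\<beta> * v), deriv f u * cosh (\<beta> * v)])"

definition mean_curvature ::
  "nat \<Rightarrow> nat \<Rightarrow> (real \<Rightarrow> real) \<Rightarrow> (real \<Rightarrow> real) \<Rightarrow> real \<Rightarrow> real \<Rightarrow> real \<Rightarrow> real" where
  "mean_curvature i j f g \<alpha> \<beta> u =
    (if j \<noteq> i then 0 else
      let \<epsilon> = (-1) ^ i;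
          f' = deriv f u; f'' = deriv (deriv f) u;
          g' = deriv g u; g'' = deriv (deriv g) u
      in ((f' * g'' - f'' * g') * ((\<alpha> * f u)\<^sup>2 + \<epsilon> * (\<beta> * g u)\<^sup>2)
            - \<epsilon> * (\<alpha>\<^sup>2 * f u * g' + \<beta>\<^sup>2 * g u * f') * (- \<epsilon> * f'\<^sup>2 + g'\<^sup>2)) /
         (2 * (- \<epsilon> * f'\<^sup>2 + g'\<^sup>2) powr (3 / 2) * ((\<alpha> * f u)\<^sup>2 + \<epsilon> * (\<beta> * g u)\<^sup>2)))"

text \<open>The weighted notions for the density \<open>exp \<circ> \<phi>\<close> take the exponent \<open>\<phi>\<close> as argument.\<close>

definition weighted_mean_curvature_fun ::
  "nat \<Rightarrow> nat \<Rightarrow> (real \<Rightarrow> real) \<Rightarrow> (real \<Rightarrow> real) \<Rightarrow> real \<Rightarrow> real \<Rightarrow>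
   (real ^ 4 \<Rightarrow> real) \<Rightarrow> real \<Rightarrow> real \<Rightarrow> real" where
  "weighted_mean_curvature_fun i j f g \<alpha> \<beta> \<phi> u v =
    mean_curvature i j f g \<alpha> \<beta> u
      - 1 / 2 * frechet_derivative \<phi> (at (rotational_surface i f g \<alpha> \<beta> u v))
                  (normal_frame i j f g \<alpha> \<beta> u v)"

definition weighted_mean_curvature_vector ::
  "nat \<Rightarrow> (real \<Rightarrow> real) \<Rightarrow> (real \<Rightarrow> real) \<Rightarrow> real \<Rightarrow> real \<Rightarrow>
   (real ^ 4 \<Rightarrow> real) \<Rightarrow> real \<Rightarrow> real \<Rightarrow> real ^ 4" where
  "weighted_mean_curvature_vector i f g \<alpha> \<beta> \<phi> u v =
    weighted_mean_curvature_fun i 1 f g \<alpha> \<beta> \<phi> u v *\<^sub>R normal_frame i 1 f g \<alpha> \<beta> u v +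
    weighted_mean_curvature_fun i 2 f g \<alpha> \<beta> \<phi> u v *\<^sub>R normal_frame i 2 f g \<alpha> \<beta> u v"

definition weighted_mean_curvature ::
  "nat \<Rightarrow> (real \<Rightarrow> real) \<Rightarrow> (real \<Rightarrow> real) \<Rightarrow> real \<Rightarrow> real \<Rightarrow>
   (real ^ 4 \<Rightarrow> real) \<Rightarrow> real \<Rightarrow> real \<Rightarrow> real" where
  "weighted_mean_curvature i f g \<alpha> \<beta> \<phi> u v =
    lorentz_norm (weighted_mean_curvature_vector i f g \<alpha> \<beta> \<phi> u v)"

definition weighted_minimal ::
  "nat \<Rightarrow> real set \<Rightarrow> (real \<Rightarrow> real) \<Rightarrow> (real \<Rightarrow> real) \<Rightarrow> real \<Rightarrow> real \<Rightarrow>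
   (real ^ 4 \<Rightarrow> real) \<Rightarrow> bool" where
  "weighted_minimal i J f g \<alpha> \<beta> \<phi> \<longleftrightarrow>
    (\<forall>u\<in>J. \<forall>v\<in>{0..<2 * pi}. weighted_mean_curvature i f g \<alpha> \<beta> \<phi> u v = 0)"

end

theory Submission
  imports Defs
begin

text \<open>
  The density exponent \<open>\<phi> = \<lambda>(x\<^sup>2 + y\<^sup>2) + \<mu>(z\<^sup>2 - t\<^sup>2)\<close> is invariant under the rotations of the
  \<open>xy\<close>-plane and the boosts of the \<open>zt\<close>-plane, and the surface is swept out from a curve by such motions. Of the
  two normals, one is built from the rotation and boost directions alone, so \<open>\<phi>\<close> is stationary along
  it (\<open>density_derivative_other_normal\<close>); this is also the normal along which the mean curvature
  vanishes. The weighted mean curvature vector is therefore a multiple of the other normal, the one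
  of index \<open>i\<close>. That normal is a spacelike unit vector (\<open>lorentz_inner_normal_frame\<close>), so the
  Lorentz norm of the vector is the absolute value of the coefficient, and no cancellation
  along null directions can occur (\<open>weighted_mean_curvature_eq_abs\<close>).

  Along the normal of index \<open>i\<close> the angles cancel and the derivative of \<open>\<phi>\<close> is
  \<open>(2\<lambda>fg' - 2\<mu>gf') / \<surd>W\<close> with \<open>W = -\<epsilon>f'\<^sup>2 + g'\<^sup>2\<close> (\<open>density_derivative_main_normal\<close>). Putting the coefficient over the
  common denominator \<open>2W\<^sup>3\<^sup>/\<^sup>2D\<close>, \<open>D = (\<alpha>f)\<^sup>2 + \<epsilon>(\<beta>g)\<^sup>2\<close>, (\<open>weighted_coefficient_over_common_denominator\<close>)
  leaves a numerator that \<open>\<epsilon>\<^sup>2 = 1\<close> turns into the left side of the asserted equation. The denominator does not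
  vanish, because the surface is timelike.
\<close>

lemma frechet_derivative_quadratic_density:
  fixes lam \<mu> :: real and p h :: "real ^ 4"
  shows "frechet_derivative
           (\<lambda>p. lam * ((p $ 1)\<^sup>2 + (p $ 2)\<^sup>2) + \<mu> * ((p $ 3)\<^sup>2 - (p $ 4)\<^sup>2)) (at p) h
         = 2 * lam * (p $ 1 * h $ 1 + p $ 2 * h $ 2) + 2 * \<mu> * (p $ 3 * h $ 3 - p $ 4 * h $ 4)"
proof -
  have "((\<lambda>p :: real ^ 4. lam * ((p $ 1)\<^sup>2 + (p $ 2)\<^sup>2) + \<mu> * ((p $ 3)\<^sup>2 - (p $ 4)\<^sup>2)) has_derivative
          (\<lambda>h. 2 * lam * (p $ 1 * h $ 1 + p $ 2 * h $ 2) + 2 * \<mu> * (p $ 3 * h $ 3 - p $ 4 * h $ 4)))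
        (at p)"
    by (auto intro!: derivative_eq_intros bounded_linear_imp_has_derivative
          bounded_linear_vec_nth simp: algebra_simps)
  from frechet_derivative_at[OF this] show ?thesis by metis
qed

lemma timelike_rotational_surface_nondegenerate:
  assumes "i \<in> {1, 2}" and "timelike_rotational_surface i J f g \<alpha> \<beta>" and "u \<in> J"
  shows "- ((-1) ^ i) * (deriv f u)\<^sup>2 + (deriv g u)\<^sup>2 > 0"
    and "(\<alpha> * f u)\<^sup>2 + (-1) ^ i * (\<beta> * g u)\<^sup>2 \<noteq> 0"
  using assms by (force simp: timelike_rotational_surface_def power_mult_distrib)+

lemma lorentz_inner_normal_frame:
  assumes "i \<in> {1, 2}" and "- ((-1) ^ i) * (deriv f u)\<^sup>2 + (deriv g u)\<^sup>2 > 0"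
  shows "lorentz_inner (normal_frame i i f g \<alpha> \<beta> u v) (normal_frame i i f g \<alpha> \<beta> u v) = 1"
proof -
  define W where "W = - ((-1) ^ i) * (deriv f u)\<^sup>2 + (deriv g u)\<^sup>2"
  have W: "W > 0" using assms(2) by (simp add: W_def)
  have "lorentz_inner (normal_frame i i f g \<alpha> \<beta> u v) (normal_frame i i f g \<alpha> \<beta> u v)
        = (1 / sqrt W)\<^sup>2 * ((deriv g u)\<^sup>2 * ((cos (\<alpha> * v))\<^sup>2 + (sin (\<alpha> * v))\<^sup>2)
            - (-1) ^ i * (deriv f u)\<^sup>2 * ((cosh (\<beta> * v))\<^sup>2 - (sinh (\<beta> * v))\<^sup>2))"
    using assms(1)
    by (auto simp: lorentz_inner_def normal_frame_def W_def algebra_simps power2_eq_square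
          simp del: sin_cos_squared_add sin_cos_squared_add2 sin_cos_squared_add3)
  also have "\<dots> = (1 / sqrt W)\<^sup>2 * W"
    by (simp add: W_def cosh_square_eq)
  also have "\<dots> = 1"
    using W by (simp add: power_divide)
  finally show ?thesis .
qed

text \<open>The \<open>xy\<close> part of this normal is tangent to a circle \<open>x\<^sup>2 + y\<^sup>2 = const\<close> and its \<open>zt\<close> part
  to a hyperbola \<open>z\<^sup>2 - t\<^sup>2 = const\<close>, so it is tangent to a level set of each of the two terms of
  the density exponent.\<close>

lemma density_derivative_other_normal:
  assumes "i \<in> {1, 2}" and "j \<in> {1, 2}" and "j \<noteq> i"
    and "\<phi> = (\<lambda>p. lam * ((p $ 1)\<^sup>2 + (p $ 2)\<^sup>2) + \<mu> * ((p $ 3)\<^sup>2 - (p $ 4)\<^sup>2))"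
  shows "frechet_derivative \<phi> (at (rotational_surface i f g \<alpha> \<beta> u v))
           (normal_frame i j f g \<alpha> \<beta> u v) = 0"
  unfolding assms(4) frechet_derivative_quadratic_density
  using assms(1-3) by (auto simp: rotational_surface_def normal_frame_def algebra_simps)

lemma density_derivative_main_normal:
  assumes "i \<in> {1, 2}"
    and "\<phi> = (\<lambda>p. lam * ((p $ 1)\<^sup>2 + (p $ 2)\<^sup>2) + \<mu> * ((p $ 3)\<^sup>2 - (p $ 4)\<^sup>2))"
  shows "frechet_derivative \<phi> (at (rotational_surface i f g \<alpha> \<beta> u v))
           (normal_frame i i f g \<alpha> \<beta> u v)
         = (2 * lam * f u * deriv g u - 2 * \<mu> * g u * deriv f u)
             / sqrt (- ((-1) ^ i) * (deriv f u)\<^sup>2 + (deriv g u)\<^sup>2)"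
proof -
  define W where "W = - ((-1) ^ i) * (deriv f u)\<^sup>2 + (deriv g u)\<^sup>2"
  have "frechet_derivative \<phi> (at (rotational_surface i f g \<alpha> \<beta> u v))
           (normal_frame i i f g \<alpha> \<beta> u v)
        = 1 / sqrt W *
            (2 * lam * f u * deriv g u * ((cos (\<alpha> * v))\<^sup>2 + (sin (\<alpha> * v))\<^sup>2)
             - 2 * \<mu> * g u * deriv f u * ((cosh (\<beta> * v))\<^sup>2 - (sinh (\<beta> * v))\<^sup>2))"
    unfolding assms(2) frechet_derivative_quadratic_density using assms(1)
    by (auto simp: rotational_surface_def normal_frame_def W_def algebra_simps power2_eq_square
          simp del: sin_cos_squared_add sin_cos_squared_add2 sin_cos_squared_add3)
  also have "\<dots> = 1 / sqrt W * (2 * lam * f u * deriv g u - 2 * \<mu> * g u * deriv f u)"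
    by (simp add: cosh_square_eq)
  finally show ?thesis by (simp add: W_def)
qed

lemma weighted_mean_curvature_eq_abs:
  assumes "i \<in> {1, 2}" and "- ((-1) ^ i) * (deriv f u)\<^sup>2 + (deriv g u)\<^sup>2 > 0"
    and "\<phi> = (\<lambda>p. lam * ((p $ 1)\<^sup>2 + (p $ 2)\<^sup>2) + \<mu> * ((p $ 3)\<^sup>2 - (p $ 4)\<^sup>2))"
  shows "weighted_mean_curvature i f g \<alpha> \<beta> \<phi> u v
         = \<bar>weighted_mean_curvature_fun i i f g \<alpha> \<beta> \<phi> u v\<bar>"
proof -
  have other: "weighted_mean_curvature_fun i j f g \<alpha> \<beta> \<phi> u v = 0"
    if "j \<in> {1, 2}" "j \<noteq> i" for j
    using that density_derivative_other_normal[OF assms(1) that assms(3)]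
    by (simp add: weighted_mean_curvature_fun_def mean_curvature_def)
  have vector: "weighted_mean_curvature_vector i f g \<alpha> \<beta> \<phi> u v
        = weighted_mean_curvature_fun i i f g \<alpha> \<beta> \<phi> u v *\<^sub>R normal_frame i i f g \<alpha> \<beta> u v"
    using assms(1) other by (auto simp: weighted_mean_curvature_vector_def)
  have scale: "lorentz_inner (c *\<^sub>R V) (c *\<^sub>R V) = c\<^sup>2 * lorentz_inner V V" for c V
    by (simp add: lorentz_inner_def algebra_simps power2_eq_square)
  show ?thesis
    by (simp add: weighted_mean_curvature_def lorentz_norm_def vector scale
          lorentz_inner_normal_frame[OF assms(1,2)])
qed

lemma weighted_coefficient_over_common_denominator:
  fixes W D N P :: real
  assumes "W > 0" and "D \<noteq> 0"
  shows "N / (2 * W powr (3 / 2) * D) - 1 / 2 * (P / sqrt W)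
         = (N - D * W * P) / (2 * W powr (3 / 2) * D)"
proof -
  have "W powr (3 / 2) = W powr (1 + 1 / 2)" by simp
  also have "\<dots> = W * sqrt W"
    using assms(1) by (subst powr_add) (simp add: powr_half_sqrt)
  finally have "W powr (3 / 2) = W * sqrt W" .
  with assms show ?thesis by (simp add: field_simps)
qed

theorem theorem1:
  fixes i :: nat and J :: "real set" and f g :: "real \<Rightarrow> real"
    and \<alpha> \<beta> lam \<mu> \<epsilon> :: real and \<phi> :: "real ^ 4 \<Rightarrow> real"
  assumes "i \<in> {1, 2}"
    and "\<epsilon> = (-1) ^ i"
    and "timelike_rotational_surface i J f g \<alpha> \<beta>"
    and "\<not> (lam = 0 \<and> \<mu> = 0)"
    and "\<phi> = (\<lambda>p. lam * ((p $ 1)\<^sup>2 + (p $ 2)\<^sup>2) + \<mu> * ((p $ 3)\<^sup>2 - (p $ 4)\<^sup>2))"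
  shows "weighted_minimal i J f g \<alpha> \<beta> \<phi> \<longleftrightarrow>
    (\<forall>u\<in>J.
      let f' = deriv f u; f'' = deriv (deriv f) u;
          g' = deriv g u; g'' = deriv (deriv g) u
      in ((- 2 * \<epsilon> * \<mu> * \<alpha>\<^sup>2 * (f u)\<^sup>2 + \<beta>\<^sup>2) * f' * g u + \<alpha>\<^sup>2 * f u * g'
            - 2 * \<beta>\<^sup>2 * \<mu> * (g u) ^ 3 * f') * (f'\<^sup>2 - \<epsilon> * g'\<^sup>2)
         + ((\<alpha> * f u)\<^sup>2 + \<epsilon> * (\<beta> * g u)\<^sup>2)
            * ((- 2 * lam * f u * (- \<epsilon> * f'\<^sup>2 + g'\<^sup>2) - f'') * g' + f' * g'') = 0)"
    (is "_ \<longleftrightarrow> (\<forall>u\<in>J. ?eq u)")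
proof -
  have pointwise: "weighted_mean_curvature i f g \<alpha> \<beta> \<phi> u v = 0 \<longleftrightarrow> ?eq u" if "u \<in> J" for u v
  proof -
    define a b c d where "a = deriv f u" and "b = deriv g u"
      and "c = deriv (deriv f) u" and "d = deriv (deriv g) u"
    define W where "W = - \<epsilon> * a\<^sup>2 + b\<^sup>2"
    define D where "D = (\<alpha> * f u)\<^sup>2 + \<epsilon> * (\<beta> * g u)\<^sup>2"
    define N where "N = (a * d - c * b) * D - \<epsilon> * (\<alpha>\<^sup>2 * f u * b + \<beta>\<^sup>2 * g u * a) * W"
    define P where "P = 2 * lam * f u * b - 2 * \<mu> * g u * a"
    note nondegenerate = timelike_rotational_surface_nondegenerate[OF assms(1,3) that]
    have W: "W > 0" and D: "D \<noteq> 0"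
      using nondegenerate by (simp_all add: W_def D_def a_def b_def assms(2))
    have "weighted_mean_curvature_fun i i f g \<alpha> \<beta> \<phi> u v
          = N / (2 * W powr (3 / 2) * D) - 1 / 2 * (P / sqrt W)"
      unfolding weighted_mean_curvature_fun_def density_derivative_main_normal[OF assms(1,5)]
      by (simp add: mean_curvature_def Let_def N_def P_def W_def D_def a_def b_def c_def d_def
            assms(2))
    also have "\<dots> = (N - D * W * P) / (2 * W powr (3 / 2) * D)"
      by (rule weighted_coefficient_over_common_denominator[OF W D])
    finally have "weighted_mean_curvature i f g \<alpha> \<beta> \<phi> u v = 0 \<longleftrightarrow> N - D * W * P = 0"
      using W D by (simp add: weighted_mean_curvature_eq_abs[OF assms(1) nondegenerate(1) assms(5)])
    also have "N - D * W * P = ((- 2 * \<epsilon> * \<mu> * \<alpha>\<^sup>2 * (f u)\<^sup>2 + \<beta>\<^sup>2) * a * g u + \<alpha>\<^sup>2 * f u * b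
            - 2 * \<beta>\<^sup>2 * \<mu> * (g u) ^ 3 * a) * (a\<^sup>2 - \<epsilon> * b\<^sup>2)
         + D * ((- 2 * lam * f u * W - c) * b + a * d)"
    proof -
      \<comment> \<open>Only \<open>\<epsilon>\<^sup>2 = 1\<close> matters: it gives \<open>a\<^sup>2 - \<epsilon>b\<^sup>2 = -\<epsilon>W\<close>, and it turns \<open>\<epsilon>D\<close> into the terms
        \<open>\<epsilon>\<alpha>\<^sup>2f\<^sup>2 + \<beta>\<^sup>2g\<^sup>2\<close> that multiply \<open>-2\<mu>\<close>.\<close>
      have e: "\<epsilon> * \<epsilon> = 1" using assms(1,2) by auto
      show ?thesis
        unfolding N_def P_def W_def D_def using e by algebra
    qed
    finally show ?thesis
      by (simp add: Let_def W_def D_def a_def b_def c_def d_def)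
  qed
  show ?thesis
  proof
    assume minimal: "weighted_minimal i J f g \<alpha> \<beta> \<phi>"
    show "\<forall>u\<in>J. ?eq u"
    proof
      fix u assume u: "u \<in> J"
      have "weighted_mean_curvature i f g \<alpha> \<beta> \<phi> u 0 = 0"
        using minimal u by (simp add: weighted_minimal_def)
      then show "?eq u" by (rule iffD1[OF pointwise[OF u]])
    qed
  next
    assume "\<forall>u\<in>J. ?eq u"
    then show "weighted_minimal i J f g \<alpha> \<beta> \<phi>"
      unfolding weighted_minimal_def using pointwise by blast
  qed
qed

end
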